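(* Let $$P=\operatorname{conv}\{(0,2,5),\,(0,-2,5),\,(0,1,-6),\,(1,-8,5),\,(1,2,-5),\,(1,-4,-3)\}\subset\mathbb{R}^3.$$ Then $P$ is a lattice polytope of lattice width one, and there is no basis of $\mathbb{Z}^3$ that is reduced with respect to $P$ and computes the lattice size $\operatorname{ls}_\Delta(P)$.
   Context: A lattice polytope in $\mathbb{R}^d$ is a convex polytope all of whose vertices lie in $\mathbb{Z}^d$. $\mathrm{AGL}(d,\mathbb{Z})$ is the group of affine unimodular maps $T(x)=Ax+h$ with $A\in\mathrm{GL}(d,\mathbb{Z})$ and $h\in\mathbb{Z}^d$. $\Delta=\operatorname{conv}\{0,e_1,e_2,e_3\}\subset\mathbb{R}^3$ is the standard simplex. For a matrix $A$, $AP=\{Ax: x\in P\}$. Lattice size: $\operatorname{ls}_\Delta(P)$ is the smallest $l\ge 0$ such that $T(P)\subset l\Delta$ for some $T\in \mathrm{AGL}(3,\mathbb{Z})$. Naive lattice size: $\operatorname{nls}_\Delta(P)$ is the smallest $l$ such that $T(P)\subset l\Delta$ for some $T$ that is a composition of multiplication by a diagonal matrix with entries $\pm1$ on the diagonal and a lattice translation. A basis $(h_1,h_2,h_3)$ of $\mathbb{Z}^3$ computes $\operatorname{ls}_\Delta(P)$ if $\operatorname{ls}_\Delta(P)=\operatorname{nls}_\Delta(AP)$, where $A$ is the matrix with rows $h_1,h_2,h_3$. For $h\in\mathbb{R}^3$, $\operatorname{w}_h(P)=\max_{x\in P}\langle h,x\rangle-\min_{x\in P}\langle h,x\rangle$,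 and the lattice width of $P$ is the minimum of $\operatorname{w}_h(P)$ over nonzero primitive $h\in\mathbb{Z}^3$. Write $\Vert h\Vert=\operatorname{w}_h(P)$. A basis $(h_1,h_2,h_3)$ of $\mathbb{Z}^3$ is reduced with respect to $P$ if (1) $\Vert h_1\Vert\le\Vert h_2\Vert\le\Vert h_3\Vert$; (2) $\Vert h_1\pm h_2\Vert\ge\Vert h_2\Vert$ (both signs); (3) $\Vert mh_1+nh_2+h_3\Vert\ge\Vert h_3\Vert$ for all $m,n\in\mathbb{Z}$. *)

theory Defs
  imports "HOL-Analysis.Analysis"
begin

text \<open>
  Elements of \<open>\<int>\<^sup>d\<close> are vectors of type \<open>int ^ 'd\<close>; the following is the inclusion
  \<open>\<int>\<^sup>d \<subseteq> \<real>\<^sup>d\<close>.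
\<close>

definition real_vec :: "int ^ 'd \<Rightarrow> real ^ 'd" where
  "real_vec h = (\<chi> i. real_of_int (h $ i))"

definition lattice_polytope :: "(real ^ 'd) set \<Rightarrow> bool" where
  "lattice_polytope P \<longleftrightarrow>
     polytope P \<and> (\<forall>v. v extreme_point_of P \<longrightarrow> v \<in> range real_vec)"

text \<open>
  Here \<open>invertible A\<close>, for an integer matrix \<open>A\<close>, asks for an integer inverse, that is
  \<open>A \<in> GL(d, \<int>)\<close>.
\<close>

definition AGL_int :: "(real ^ 'd \<Rightarrow> real ^ 'd) set" where
  "AGL_int = {T. \<exists>(A :: int ^ 'd ^ 'd) (h :: int ^ 'd). invertible A \<and>
                   T = (\<lambda>x. map_matrix real_of_int A *v x + real_vec h)}"

definition signed_translations :: "(real ^ 'd \<Rightarrow> real ^ 'd) set" where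
  "signed_translations =
     {T. \<exists>(D :: int ^ 'd ^ 'd) (h :: int ^ 'd).
           (\<forall>i. D $ i $ i \<in> {1, -1}) \<and> (\<forall>i j. i \<noteq> j \<longrightarrow> D $ i $ j = 0) \<and>
           T = (\<lambda>x. map_matrix real_of_int D *v x + real_vec h)}"

definition std_simplex :: "(real ^ 3) set" where
  "std_simplex = convex hull {0, axis 1 1, axis 2 1, axis 3 1}"

text \<open>
  \<open>l\<close> ranges over the nonnegative reals. For a nonempty lattice polytope both minima below
  exist (and are integers), so \<open>LEAST\<close> denotes an actual minimum.
\<close>

definition lattice_size :: "(real ^ 3) set \<Rightarrow> real" where
  "lattice_size P =
     (LEAST l. 0 \<le> l \<and> (\<exists>T\<in>AGL_int. T ` P \<subseteq> (*\<^sub>R) l ` std_simplex))"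

definition naive_lattice_size :: "(real ^ 3) set \<Rightarrow> real" where
  "naive_lattice_size P =
     (LEAST l. 0 \<le> l \<and> (\<exists>T\<in>signed_translations. T ` P \<subseteq> (*\<^sub>R) l ` std_simplex))"

definition lattice_basis :: "int ^ 3 \<Rightarrow> int ^ 3 \<Rightarrow> int ^ 3 \<Rightarrow> bool" where
  "lattice_basis h1 h2 h3 \<longleftrightarrow>
     (\<forall>v. \<exists>!(a, b, c). v = a *s h1 + b *s h2 + c *s h3)"

text \<open>\<open>vector [h1, h2, h3]\<close> is the matrix with rows \<open>h1\<close>, \<open>h2\<close>, \<open>h3\<close>.\<close>

definition computes_lattice_size ::
  "(real ^ 3) set \<Rightarrow> int ^ 3 \<Rightarrow> int ^ 3 \<Rightarrow> int ^ 3 \<Rightarrow> bool" where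
  "computes_lattice_size P h1 h2 h3 \<longleftrightarrow>
     lattice_size P =
       naive_lattice_size ((*v) (map_matrix real_of_int (vector [h1, h2, h3])) ` P)"

text \<open>For nonempty compact \<open>P\<close> the supremum and the infimum are attained.\<close>

definition width :: "(real ^ 'd) set \<Rightarrow> real ^ 'd \<Rightarrow> real" where
  "width P h = (SUP x\<in>P. h \<bullet> x) - (INF x\<in>P. h \<bullet> x)"

definition primitive :: "int ^ 'd \<Rightarrow> bool" where
  "primitive h \<longleftrightarrow> (GCD i\<in>UNIV. h $ i) = 1"

text \<open>
  For a nonempty lattice polytope all these widths are natural numbers, so the minimum exists.
\<close>

definition lattice_width :: "(real ^ 'd) set \<Rightarrow> real" where
  "lattice_width P =
     (LEAST w. \<exists>h :: int ^ 'd. h \<noteq> 0 \<and> primitive h \<and> w = width P (real_vec h))"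

definition reduced_basis :: "(real ^ 3) set \<Rightarrow> int ^ 3 \<Rightarrow> int ^ 3 \<Rightarrow> int ^ 3 \<Rightarrow> bool" where
  "reduced_basis P h1 h2 h3 \<longleftrightarrow>
     (let N = (\<lambda>h. width P (real_vec h)) in
        lattice_basis h1 h2 h3 \<and>
        N h1 \<le> N h2 \<and> N h2 \<le> N h3 \<and>
        N (h1 + h2) \<ge> N h2 \<and> N (h1 - h2) \<ge> N h2 \<and>
        (\<forall>m n :: int. N (m *s h1 + n *s h2 + h3) \<ge> N h3))"

end

theory Submission
  imports Defs
begin

text \<open>
  If \<open>(h1, h2, h3)\<close> is reduced and \<open>v = a h1 + b h2 + c h3\<close> with \<open>\<parallel>v\<parallel> < \<parallel>h3\<parallel>\<close>, then rounding
  \<open>a / c\<close> and \<open>b / c\<close> to nearest integers shows that \<open>c\<close> is even. Not all three unit vectors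
  can have an even coefficient at \<open>h3\<close>, so \<open>\<parallel>h3\<parallel> \<le> max \<parallel>e\<^sub>i\<parallel>\<close>. For the polytope of the theorem
  this maximum is 11, and the vectors of width at most 11 are, up to sign, of the form \<open>(k, 0, 0)\<close>,
  \<open>(k, 1, 0)\<close>, \<open>(0, 0, 1)\<close> or \<open>(1, 0, -1)\<close>. Two members of a reduced basis outside the line of
  \<open>e\<^sub>1\<close> cannot have \<open>\<plusminus>e\<^sub>1\<close> as sum or difference, because \<open>\<parallel>e\<^sub>1\<parallel> = 1\<close>. Hence a reduced basis
  consists, up to order and signs, of \<open>e\<^sub>1\<close>, some \<open>(k, 1, 0)\<close>, and one of \<open>(0, 0, 1)\<close> and
  \<open>(1, 0, -1)\<close>; the naive lattice size in every such basis is at least 14. On the other hand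
  the rows \<open>(1, 0, 0)\<close>, \<open>(0, -1, 0)\<close>, \<open>(-8, -1, -1)\<close> map the polytope into a translate of
  \<open>13\<Delta>\<close>.
\<close>

section \<open>The width as a seminorm\<close>

lemma real_vec_simps:
  "real_vec (u + v) = real_vec u + real_vec v"
  "real_vec (k *s u) = real_of_int k *\<^sub>R real_vec u"
  by (simp_all add: real_vec_def vec_eq_iff)

lemma bdd_inner:
  fixes P :: "(real ^ 'd) set"
  assumes "bounded P"
  shows "bdd_above ((\<bullet>) h ` P)" "bdd_below ((\<bullet>) h ` P)"
  using bounded_linear_image[OF assms bounded_linear_inner_right[of h]]
  by (auto intro: bounded_imp_bdd_above bounded_imp_bdd_below)

lemma width_ge:
  assumes "bounded P" "x \<in> P" "y \<in> P"
  shows "h \<bullet> x - h \<bullet> y \<le> width P h"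
  unfolding width_def
  using cSUP_upper[OF assms(2) bdd_inner(1)[OF assms(1)], of h]
    cINF_lower[OF bdd_inner(2)[OF assms(1)] assms(3), of h] by simp

lemma width_le:
  assumes "P \<noteq> {}" "\<And>x y. x \<in> P \<Longrightarrow> y \<in> P \<Longrightarrow> h \<bullet> x - h \<bullet> y \<le> w"
  shows "width P h \<le> w"
proof -
  have "(SUP x\<in>P. h \<bullet> x) \<le> w + h \<bullet> y" if "y \<in> P" for y
    using assms that by (intro cSUP_least) (auto simp: algebra_simps)
  then have "(SUP x\<in>P. h \<bullet> x) - w \<le> (INF y\<in>P. h \<bullet> y)"
    using assms(1) by (intro cINF_greatest) (auto simp: algebra_simps)
  then show ?thesis by (simp add: width_def)
qed

lemma width_nonneg:
  assumes "bounded P" "P \<noteq> {}"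
  shows "0 \<le> width P h"
  using width_ge[OF assms(1)] assms(2) by fastforce

lemma width_triangle:
  assumes "bounded P" "P \<noteq> {}"
  shows "width P (g + h) \<le> width P g + width P h"
proof (rule width_le[OF assms(2)])
  fix x y assume "x \<in> P" "y \<in> P"
  then show "(g + h) \<bullet> x - (g + h) \<bullet> y \<le> width P g + width P h"
    using width_ge[OF assms(1), of x y g] width_ge[OF assms(1), of x y h]
    by (simp add: inner_add_left)
qed

lemma width_scaleR_le:
  assumes "bounded P" "P \<noteq> {}"
  shows "width P (c *\<^sub>R h) \<le> \<bar>c\<bar> * width P h"
proof (rule width_le[OF assms(2)])
  fix x y assume xy: "x \<in> P" "y \<in> P"
  have "\<bar>h \<bullet> x - h \<bullet> y\<bar> \<le> width P h"
    using width_ge[OF assms(1) xy, of h] width_ge[OF assms(1) xy(2,1), of h] by simp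
  then have "\<bar>c\<bar> * \<bar>h \<bullet> x - h \<bullet> y\<bar> \<le> \<bar>c\<bar> * width P h"
    by (rule mult_left_mono) simp
  moreover have "c * (h \<bullet> x - h \<bullet> y) \<le> \<bar>c\<bar> * \<bar>h \<bullet> x - h \<bullet> y\<bar>"
    by (metis abs_ge_self abs_mult)
  ultimately show "(c *\<^sub>R h) \<bullet> x - (c *\<^sub>R h) \<bullet> y \<le> \<bar>c\<bar> * width P h"
    by (simp add: algebra_simps)
qed

text \<open>The reverse inequality comes from \<open>width_scaleR_le\<close> with the factor
  \<open>1 / c\<close> applied to the scaled vector, so \<open>c = 0\<close> is treated
  separately.\<close>

lemma width_scaleR:
  assumes "bounded P" "P \<noteq> {}"
  shows "width P (c *\<^sub>R h) = \<bar>c\<bar> * width P h"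
proof (cases "c = 0")
  case True
  then show ?thesis
    using width_scaleR_le[OF assms, of c h] width_nonneg[OF assms, of "c *\<^sub>R h"] by simp
next
  case False
  have "width P h \<le> \<bar>1 / c\<bar> * width P (c *\<^sub>R h)"
    using width_scaleR_le[OF assms, of "1 / c" "c *\<^sub>R h"] False by simp
  then show ?thesis
    using width_scaleR_le[OF assms, of c h] False by (simp add: field_simps)
qed

section \<open>Parity of coefficients and the longest vector of a reduced basis\<close>

lemma balanced_division:
  fixes a c :: int
  assumes "c \<noteq> 0"
  obtains q r where "a = c * q + r" "2 * \<bar>r\<bar> \<le> \<bar>c\<bar>"
proof
  define d where "d = \<bar>c\<bar>"
  define k where "k = d div 2"
  \<comment> \<open>Shifting by half of d before reducing modulo d centers the remainder: -k <= s <=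
    d - 1 - k <= k. The sign of c is moved into the quotient.\<close>
  define s where "s = (a + k) mod d - k"
  have d: "d > 0" using assms by (simp add: d_def)
  have "a = d * ((a + k) div d) + s"
    unfolding s_def using mult_div_mod_eq[of d "a + k"] by linarith
  then show "a = c * (sgn c * ((a + k) div d)) + s"
    by (metis d_def abs_sgn mult.assoc)
  have "2 * k \<le> d" "d \<le> 2 * k + 1" unfolding k_def by linarith+
  then show "2 * \<bar>s\<bar> \<le> \<bar>c\<bar>"
    using pos_mod_sign[OF d, of "a + k"] pos_mod_bound[OF d, of "a + k"]
    unfolding s_def d_def[symmetric] by (smt (verit))
qed

text \<open>For nonzero c, rounding leaves remainders r, s with |r|, |s| <= |c| / 2, while comparing
  widths gives |c| <= |r| + |s|. Both remainders must then be exactly |c| / 2 in absolute value,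
  which an odd c does not allow. The last condition of \<open>reduced_basis\<close> bounds the width
  of the rounded vector \<open>g\<close> from below.\<close>

lemma reduced_basis_coeff_even:
  assumes P: "bounded P" "P \<noteq> {}"
    and red: "reduced_basis P h1 h2 h3"
    and v: "v = a *s h1 + b *s h2 + c *s h3"
    and less: "width P (real_vec v) < width P (real_vec h3)"
  shows "even c"
proof (cases "c = 0")
  case False
  let ?N = "\<lambda>h. width P (real_vec h)"
  obtain m r where a: "a = c * m + r" and r: "2 * \<bar>r\<bar> \<le> \<bar>c\<bar>"
    using balanced_division[OF False] .
  obtain n s where b: "b = c * n + s" and s: "2 * \<bar>s\<bar> \<le> \<bar>c\<bar>"
    using balanced_division[OF False] .
  define g where "g = m *s h1 + n *s h2 + h3"
  have N: "?N h1 \<le> ?N h2" "?N h2 \<le> ?N h3" "?N h3 \<le> ?N g"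
    using red by (auto simp: reduced_basis_def Let_def g_def)
  \<comment> \<open>\<open>c g\<close> differs from \<open>v\<close> only by the rounding error \<open>r h1 + s h2\<close>\<close>
  have "c *s g = v + ((- r) *s h1 + (- s) *s h2)"
    unfolding g_def v a b by (simp add: vec_eq_iff algebra_simps)
  then have "\<bar>c\<bar> * ?N g = width P (real_vec v +
      (real_of_int (- r) *\<^sub>R real_vec h1 + real_of_int (- s) *\<^sub>R real_vec h2))"
    using width_scaleR[OF P, of "real_of_int c" "real_vec g"]
    by (metis real_vec_simps of_int_abs)
  also have "\<dots> \<le> ?N v + (\<bar>real_of_int (- r)\<bar> * ?N h1 + \<bar>real_of_int (- s)\<bar> * ?N h2)"
    by (metis (no_types, lifting) width_triangle[OF P] width_scaleR[OF P]
        add_left_mono order_trans)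
  also have "\<dots> < ?N h3 + (\<bar>r\<bar> * ?N h3 + \<bar>s\<bar> * ?N h3)"
    using less N by (intro add_less_le_mono add_mono) (auto intro!: mult_left_mono)
  finally have "\<bar>c\<bar> * ?N g < (1 + \<bar>r\<bar> + \<bar>s\<bar>) * ?N h3"
    by (simp add: algebra_simps)
  moreover have "\<bar>c\<bar> * ?N h3 \<le> \<bar>c\<bar> * ?N g"
    using N by (intro mult_left_mono) auto
  ultimately have "real_of_int \<bar>c\<bar> * ?N h3 < real_of_int (1 + \<bar>r\<bar> + \<bar>s\<bar>) * ?N h3"
    by simp
  then have "\<bar>c\<bar> < 1 + \<bar>r\<bar> + \<bar>s\<bar>"
    using width_nonneg[OF P, of "real_vec h3"] by (metis mult_right_less_imp_less of_int_less_iff)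
  then have "\<bar>c\<bar> = 2 * \<bar>r\<bar>" using r s by linarith
  then show ?thesis by (metis dvd_triv_left dvd_abs_iff)
qed simp

lemma reduced_basis_width_le:
  assumes P: "bounded P" "P \<noteq> {}"
    and red: "reduced_basis P h1 h2 h3"
    and w: "\<And>i. width P (real_vec (axis i 1)) \<le> w"
  shows "width P (real_vec h3) \<le> w"
proof (rule ccontr)
  assume "\<not> ?thesis"
  then have less: "width P (real_vec (axis i 1)) < width P (real_vec h3)" for i
    using w[of i] by simp
  have basis: "\<And>v. \<exists>!(a, b, c). v = a *s h1 + b *s h2 + c *s h3"
    using red by (simp add: reduced_basis_def Let_def lattice_basis_def)
  then have "\<exists>a b c. axis i 1 = a *s h1 + b *s h2 + c *s h3" for i
    by (metis (mono_tags, lifting) case_prod_unfold)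
  then obtain a b c where abc: "\<And>i. axis i 1 = a i *s h1 + b i *s h2 + c i *s h3"
    by metis
  have even: "even (c i)" for i
    using reduced_basis_coeff_even[OF P red abc less] .
  let ?s = "\<lambda>f. \<Sum>i\<in>UNIV. h3 $ i * f i"
  \<comment> \<open>Expanding h3 in unit vectors and these in the basis gives h3 an even coefficient
    at itself; uniqueness says that this coefficient is 1.\<close>
  have "h3 = (\<Sum>i\<in>UNIV. h3 $ i *s axis i 1)"
    by (rule basis_expansion[symmetric])
  also have "\<dots> = ?s a *s h1 + ?s b *s h2 + ?s c *s h3"
    by (simp add: abc vec_eq_iff sum.distrib sum_distrib_left sum_distrib_right algebra_simps)
  finally have "h3 = ?s a *s h1 + ?s b *s h2 + ?s c *s h3" .
  moreover have "h3 = 0 *s h1 + 0 *s h2 + 1 *s h3" by simp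
  ultimately have "(?s a, ?s b, ?s c) = (0, 0, 1)"
    using basis[of h3] by (smt (verit) case_prod_conv)
  moreover have "even (?s c)" using even by (intro dvd_sum) auto
  ultimately show False by simp
qed

section \<open>Lattice maps into dilated simplices and attained minima\<close>

lemma dilated_simplex_iff:
  assumes "0 \<le> l"
  shows "x \<in> (*\<^sub>R) l ` std_simplex \<longleftrightarrow> (\<forall>i. 0 \<le> x $ i) \<and> (\<Sum>i\<in>UNIV. x $ i) \<le> l"
proof -
  have B: "Basis = {axis 1 1, axis 2 1, axis 3 1 :: real ^ 3}"
    by (auto simp: Basis_vec_def UNIV_3)
  have "(\<Sum>b\<in>Basis. y \<bullet> b) = (\<Sum>i\<in>UNIV. y $ i)" for y :: "real ^ 3"
    by (simp add: B axis_eq_axis inner_axis sum_3)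
  moreover have "(\<forall>b\<in>Basis. 0 \<le> y \<bullet> b) \<longleftrightarrow> (\<forall>i. 0 \<le> y $ i)" for y :: "real ^ 3"
    by (auto simp: Basis_vec_def inner_axis)
  ultimately have std: "y \<in> std_simplex \<longleftrightarrow> (\<forall>i. 0 \<le> y $ i) \<and> (\<Sum>i\<in>UNIV. y $ i) \<le> 1" for y
    using Starlike.std_simplex[where 'a = "real ^ 3"] by (simp add: Defs.std_simplex_def B)
  show ?thesis
  proof (cases "l = 0")
    case True
    \<comment> \<open>Division by l is impossible here; nonnegative coordinates with sum at most 0
      leave only the origin.\<close>
    have "x = 0" if "\<forall>i. 0 \<le> x $ i" "(\<Sum>i\<in>UNIV. x $ i) \<le> 0"
      using that sum_nonneg_eq_0_iff[of UNIV "\<lambda>i. x $ i"]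
      by (auto simp: vec_eq_iff intro: order_antisym sum_nonneg)
    moreover have "0 \<in> std_simplex" by (simp add: std)
    ultimately show ?thesis using True by auto
  next
    case False
    then have l: "l > 0" using assms by simp
    then have "x \<in> (*\<^sub>R) l ` std_simplex \<longleftrightarrow> (1 / l) *\<^sub>R x \<in> std_simplex"
      by (force intro: image_eqI[where x = "(1 / l) *\<^sub>R x"])
    also have "\<dots> \<longleftrightarrow> (\<forall>i. 0 \<le> x $ i) \<and> (\<Sum>i\<in>UNIV. x $ i) \<le> l"
      using l by (simp add: std zero_le_divide_iff flip: sum_divide_distrib)
    finally show ?thesis .
  qed
qed

lemma matrix_real_vec: "map_matrix real_of_int A *v real_vec v = real_vec (A *v v)"
  by (simp add: real_vec_def vec_eq_iff matrix_vector_mult_def map_matrix_def)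

lemma matrix_image_hull:
  "(*v) (map_matrix real_of_int A) ` (convex hull (real_vec ` W)) = convex hull (real_vec ` ((*v) A ` W))"
  by (simp add: convex_hull_linear_image image_image matrix_real_vec)

text \<open>An affine map sends a hull to the hull of the images, and the dilated simplex is convex,
  so testing the generators suffices. Inclusions thereby become inequalities between integers and
  l.\<close>

lemma affine_image_subset_simplex_iff:
  assumes "0 \<le> l"
  shows "(\<lambda>x. map_matrix real_of_int A *v x + real_vec h) ` (convex hull (real_vec ` W))
           \<subseteq> (*\<^sub>R) l ` std_simplex \<longleftrightarrow>
         (\<forall>v\<in>W. (\<forall>i. 0 \<le> (A *v v + h) $ i) \<and> real_of_int (\<Sum>i\<in>UNIV. (A *v v + h) $ i) \<le> l)"
proof -
  have "(\<lambda>x. map_matrix real_of_int A *v x + real_vec h) ` (convex hull (real_vec ` W))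
      = (+) (real_vec h) ` (convex hull (real_vec ` ((*v) A ` W)))"
    unfolding matrix_image_hull[symmetric] by (simp add: image_image add.commute)
  also have "\<dots> = convex hull (real_vec ` (\<lambda>v. A *v v + h) ` W)"
    by (simp only: convex_hull_translation[symmetric] image_image real_vec_simps add.commute)
  finally have *: "(\<lambda>x. map_matrix real_of_int A *v x + real_vec h) ` (convex hull (real_vec ` W)) = \<dots>" .
  have "convex ((*\<^sub>R) l ` std_simplex)"
    by (intro convex_scaling) (simp add: Defs.std_simplex_def)
  then show ?thesis
    unfolding * subset_hull[of convex, OF \<open>convex _\<close>]
    using assms by (simp add: image_subset_iff dilated_simplex_iff real_vec_def)
qed

text \<open>\<open>LEAST\<close> over the reals is informative only if a minimum exists. Closure
  under floor provides one: the least natural number in \<open>S\<close> lies below every element of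
  \<open>S\<close>.\<close>

lemma Least_real_floor_closed:
  fixes S :: "real set"
  assumes "s \<in> S" and S: "\<And>l. l \<in> S \<Longrightarrow> 0 \<le> l \<and> real_of_int \<lfloor>l\<rfloor> \<in> S"
  shows "(LEAST l. l \<in> S) \<in> S" "(LEAST l. l \<in> S) \<le> s"
proof -
  define n where "n = (LEAST n. real n \<in> S)"
  have floor: "real (nat \<lfloor>l\<rfloor>) \<in> S" if "l \<in> S" for l
    using S[OF that] by simp
  have n: "real n \<in> S"
    unfolding n_def using floor[OF assms(1)] by (rule LeastI)
  have le: "real n \<le> l" if "l \<in> S" for l
  proof -
    have "n \<le> nat \<lfloor>l\<rfloor>"
      unfolding n_def using floor[OF that] by (rule Least_le)
    then show ?thesis using S[OF that] by linarith
  qed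
  have "(LEAST l. l \<in> S) = real n" using n le by (rule Least_equality)
  then show "(LEAST l. l \<in> S) \<in> S" "(LEAST l. l \<in> S) \<le> s"
    using n le[OF assms(1)] by simp_all
qed

text \<open>If \<open>T\<close> is integral, an inclusion of \<open>T ` Q\<close> in \<open>l\<close> times the simplex persists when \<open>l\<close> is
  replaced by its floor; hence the minima in the two lattice sizes are attained.\<close>

lemma Least_dilation_attained:
  fixes F :: "(real ^ 3 \<Rightarrow> real ^ 3) set"
  assumes Q: "Q = convex hull (real_vec ` W)"
    and F: "\<And>T. T \<in> F \<Longrightarrow> \<exists>A h. T = (\<lambda>x. map_matrix real_of_int A *v x + real_vec h)"
    and ex: "0 \<le> k" "T \<in> F" "T ` Q \<subseteq> (*\<^sub>R) k ` std_simplex"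
  defines "m \<equiv> LEAST l. 0 \<le> l \<and> (\<exists>T\<in>F. T ` Q \<subseteq> (*\<^sub>R) l ` std_simplex)"
  shows "0 \<le> m \<and> (\<exists>T\<in>F. T ` Q \<subseteq> (*\<^sub>R) m ` std_simplex)" "m \<le> k"
proof -
  let ?S = "{l. 0 \<le> l \<and> (\<exists>T\<in>F. T ` Q \<subseteq> (*\<^sub>R) l ` std_simplex)}"
  have fl: "0 \<le> l \<and> real_of_int \<lfloor>l\<rfloor> \<in> ?S" if l: "l \<in> ?S" for l
  proof -
    from l have l0: "0 \<le> l" by simp
    from l obtain T where T: "T \<in> F" "T ` Q \<subseteq> (*\<^sub>R) l ` std_simplex" by auto
    obtain A h where Ah: "T = (\<lambda>x. map_matrix real_of_int A *v x + real_vec h)"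
      using F[OF T(1)] by auto
    have "T ` Q \<subseteq> (*\<^sub>R) (real_of_int \<lfloor>l\<rfloor>) ` std_simplex"
      using T(2) l0 unfolding Ah Q
      by (simp add: affine_image_subset_simplex_iff le_floor_iff del: of_int_sum)
    then show ?thesis using l0 T(1) by auto
  qed
  have k: "k \<in> ?S" using ex by auto
  have m: "m = (LEAST l. l \<in> ?S)" by (simp add: m_def)
  show "0 \<le> m \<and> (\<exists>T\<in>F. T ` Q \<subseteq> (*\<^sub>R) m ` std_simplex)" "m \<le> k"
    using Least_real_floor_closed[of k ?S, OF k fl] unfolding m by simp_all
qed

lemma lattice_size_le:
  assumes "Q = convex hull (real_vec ` W)" "0 \<le> k" "T \<in> AGL_int" "T ` Q \<subseteq> (*\<^sub>R) k ` std_simplex"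
  shows "lattice_size Q \<le> k"
  unfolding lattice_size_def
  using assms by (intro Least_dilation_attained(2)[of Q W]) (auto simp: AGL_int_def)

lemma naive_lattice_size_attained:
  assumes Q: "Q = convex hull (real_vec ` W)" and W: "finite W"
  obtains T where "0 \<le> naive_lattice_size Q" "T \<in> signed_translations"
    "T ` Q \<subseteq> (*\<^sub>R) (naive_lattice_size Q) ` std_simplex"
proof -
  \<comment> \<open>K bounds all coordinates in absolute value, so translating by (K, K, K) moves
    them into [0, 2K], with coordinate sum at most 6K. Some inclusion therefore exists, as
    attainment requires.\<close>
  define K where "K = (\<Sum>v\<in>W. \<Sum>i\<in>UNIV. \<bar>v $ i\<bar>)"
  have K: "\<bar>v $ i\<bar> \<le> K" if "v \<in> W" for v i
  proof -
    have "\<bar>v $ i\<bar> \<le> (\<Sum>i\<in>UNIV. \<bar>v $ i\<bar>)" by (rule member_le_sum) auto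
    also have "\<dots> \<le> K"
      unfolding K_def using W that by (intro member_le_sum[of v]) (auto intro: sum_nonneg)
    finally show ?thesis .
  qed
  have K0: "0 \<le> K" by (auto simp: K_def intro!: sum_nonneg)
  let ?T = "\<lambda>x. map_matrix real_of_int (mat 1) *v x + real_vec (\<chi> i. K)"
  have T: "?T \<in> signed_translations"
    unfolding signed_translations_def mem_Collect_eq
    by (intro exI[of _ "mat 1"] exI[of _ "\<chi> i. K"]) (simp add: mat_def)
  have "?T ` Q \<subseteq> (*\<^sub>R) (real_of_int (6 * K)) ` std_simplex"
  proof -
    have "0 \<le> v $ i + K" "v $ i + K \<le> 2 * K" if "v \<in> W" for v i
      using K[OF that, of i] by linarith+
    moreover from this have "(\<Sum>i\<in>UNIV. v $ i + K) \<le> 6 * K" if "v \<in> W" for v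
      using sum_mono[of UNIV "\<lambda>i. v $ i + K" "\<lambda>_. 2 * K"] that by simp
    ultimately show ?thesis
      using K0 unfolding Q
      by (subst affine_image_subset_simplex_iff) (simp_all only: of_int_le_iff, simp_all)
  qed
  note * = Least_dilation_attained(1)[of Q W signed_translations, OF Q _ _ T this,
      folded naive_lattice_size_def]
  show ?thesis
    using that * K0 by (fastforce simp: signed_translations_def)
qed

text \<open>A diagonal matrix with entries 1 and -1 only flips signs of rows of \<open>B\<close>. An
  optimal signed translation thus becomes signed rows \<open>g\<close> and a shift \<open>t\<close>
  subject to inequalities at the points of \<open>W\<close>.\<close>

lemma naive_lattice_size_witness:
  assumes W: "finite W"
    and Q: "Q = (*v) (map_matrix real_of_int B) ` (convex hull (real_vec ` W))"
  obtains g :: "3 \<Rightarrow> int ^ 3" and t :: "int ^ 3"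
  where "\<And>i. g i = B $ i \<or> g i = - (B $ i)"
    "\<And>v i. v \<in> W \<Longrightarrow> 0 \<le> (\<Sum>j\<in>UNIV. g i $ j * v $ j) + t $ i"
    "\<And>v. v \<in> W \<Longrightarrow>
       real_of_int (\<Sum>i\<in>UNIV. (\<Sum>j\<in>UNIV. g i $ j * v $ j) + t $ i) \<le> naive_lattice_size Q"
proof -
  have Q': "Q = convex hull (real_vec ` ((*v) B ` W))"
    unfolding Q by (rule matrix_image_hull)
  obtain T where n: "0 \<le> naive_lattice_size Q" and T: "T \<in> signed_translations"
    "T ` Q \<subseteq> (*\<^sub>R) (naive_lattice_size Q) ` std_simplex"
    using naive_lattice_size_attained[OF Q'] W by blast
  obtain D t where D: "\<And>i. D $ i $ i \<in> {1, -1}" "\<And>i j. i \<noteq> j \<Longrightarrow> D $ i $ j = 0"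
    and Teq: "T = (\<lambda>x. map_matrix real_of_int D *v x + real_vec t)"
    using T(1) unfolding signed_translations_def by blast
  define g where "g i = D $ i $ i *s B $ i" for i
  have "(D *v (B *v v)) $ i = (\<Sum>j\<in>UNIV. g i $ j * v $ j)" for v i
  proof -
    have "(D *v (B *v v)) $ i = (\<Sum>j\<in>UNIV. if j = i then D $ i $ i * (B *v v) $ i else 0)"
      unfolding matrix_vector_mult_def[of D] vec_lambda_beta using D(2) by (intro sum.cong) auto
    also have "\<dots> = D $ i $ i * (\<Sum>j\<in>UNIV. B $ i $ j * v $ j)"
      by (simp add: matrix_vector_mult_def)
    also have "\<dots> = (\<Sum>j\<in>UNIV. g i $ j * v $ j)"
      unfolding g_def sum_distrib_left by (simp add: mult.assoc)
    finally show ?thesis .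
  qed
  moreover have "g i = B $ i \<or> g i = - (B $ i)" for i
    using D(1)[of i] by (auto simp: g_def vec_eq_iff)
  ultimately show ?thesis
    using that[of g t] T(2) n
    unfolding Teq Q' by (simp add: affine_image_subset_simplex_iff)
qed

section \<open>The polytope and its widths\<close>

definition vertices :: "(int ^ 3) set" where
  "vertices = {vector [0, 2, 5], vector [0, -2, 5], vector [0, 1, -6],
               vector [1, -8, 5], vector [1, 2, -5], vector [1, -4, -3]}"

definition hull_P :: "(real ^ 3) set" where
  "hull_P = convex hull (real_vec ` vertices)"

lemma real_vec_vector3:
  "real_vec (vector [a, b, c] :: int ^ 3) = vector [real_of_int a, real_of_int b, real_of_int c]"
  by (simp add: real_vec_def vec_eq_iff forall_3)

lemma hull_P_eq:
  "hull_P = convex hull {vector [0, 2, 5], vector [0, -2, 5], vector [0, 1, -6],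
                         vector [1, -8, 5], vector [1, 2, -5], vector [1, -4, -3]}"
  by (simp add: hull_P_def vertices_def real_vec_vector3)

lemma hull_P_bounded: "bounded hull_P" and hull_P_nonempty: "hull_P \<noteq> {}"
  unfolding hull_P_def
  using finite_imp_bounded_convex_hull[of "real_vec ` vertices"] by (simp_all add: vertices_def)

lemma lattice_polytope_hull_P: "lattice_polytope hull_P"
  unfolding lattice_polytope_def
proof
  show "polytope hull_P"
    unfolding hull_P_def by (intro polytope_convex_hull) (simp add: vertices_def)
  show "\<forall>v. v extreme_point_of hull_P \<longrightarrow> v \<in> range real_vec"
    unfolding hull_P_def using extreme_point_of_convex_hull by blast
qed

lemma width_hull_P_ge:
  assumes "v \<in> vertices" "w \<in> vertices"
  shows "real_of_int (\<Sum>i\<in>UNIV. h $ i * (v $ i - w $ i)) \<le> width hull_P (real_vec h)"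
proof -
  have "real_vec u \<in> hull_P" if "u \<in> vertices" for u
    using that by (auto simp: hull_P_def intro: hull_inc)
  from width_ge[OF hull_P_bounded this[OF assms(1)] this[OF assms(2)], of "real_vec h"]
  show ?thesis
    by (simp add: real_vec_def inner_vec_def sum_3 algebra_simps)
qed

lemma width_hull_P_coord:
  "width hull_P (real_vec (axis 1 1)) \<le> 1"
  "width hull_P (real_vec (axis 2 1)) \<le> 10"
  "width hull_P (real_vec (axis 3 1)) \<le> 11"
proof -
  have le: "width hull_P (real_vec h) \<le> u - l"
    if "\<And>v. v \<in> vertices \<Longrightarrow> l \<le> real_vec h \<bullet> real_vec v \<and> real_vec h \<bullet> real_vec v \<le> u"
    for h l u
  proof (rule width_le[OF hull_P_nonempty])
    have "{x. real_vec h \<bullet> x \<in> {l..u}} = {x. l \<le> real_vec h \<bullet> x} \<inter> {x. real_vec h \<bullet> x \<le> u}"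
      by auto
    then have "convex {x. real_vec h \<bullet> x \<in> {l..u}}"
      by (simp add: convex_Int convex_halfspace_le convex_halfspace_ge[of l "real_vec h", simplified])
    then have "hull_P \<subseteq> {x. real_vec h \<bullet> x \<in> {l..u}}"
      unfolding hull_P_def using that by (intro hull_minimal) auto
    then have "l \<le> real_vec h \<bullet> x \<and> real_vec h \<bullet> x \<le> u" if "x \<in> hull_P" for x
      using that by auto
    then show "real_vec h \<bullet> x - real_vec h \<bullet> y \<le> u - l" if "x \<in> hull_P" "y \<in> hull_P" for x y
      using that by (meson diff_mono)
  qed
  have "width hull_P (real_vec (axis 1 1)) \<le> 1 - 0"
    by (rule le) (auto simp: vertices_def real_vec_def inner_vec_def sum_3 axis_def)
  moreover have "width hull_P (real_vec (axis 2 1)) \<le> 2 - (-8)"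
    by (rule le) (auto simp: vertices_def real_vec_def inner_vec_def sum_3 axis_def)
  moreover have "width hull_P (real_vec (axis 3 1)) \<le> 5 - (-6)"
    by (rule le) (auto simp: vertices_def real_vec_def inner_vec_def sum_3 axis_def)
  ultimately show "width hull_P (real_vec (axis 1 1)) \<le> 1"
    "width hull_P (real_vec (axis 2 1)) \<le> 10" "width hull_P (real_vec (axis 3 1)) \<le> 11"
    by simp_all
qed


text \<open>The forms pair h with differences of listed points, in order: (0,2,5) - (0,-2,5),
  (0,2,5) - (0,1,-6), (1,2,-5) - (1,-8,5), (1,2,-5) - (0,2,5) and (1,-8,5) - (0,1,-6).\<close>

lemma width_bound_imp:
  assumes "width hull_P (real_vec h) \<le> real_of_int k"
  shows "\<bar>4 * h $ 2\<bar> \<le> k" "\<bar>h $ 2 + 11 * h $ 3\<bar> \<le> k"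
    "\<bar>10 * h $ 2 - 10 * h $ 3\<bar> \<le> k" "\<bar>h $ 1 - 10 * h $ 3\<bar> \<le> k"
    "\<bar>h $ 1 - 9 * h $ 2 + 11 * h $ 3\<bar> \<le> k"
proof -
  have "(\<Sum>i\<in>UNIV. h $ i * (v $ i - w $ i)) \<le> k" if "v \<in> vertices" "w \<in> vertices" for v w
    using width_hull_P_ge[OF that, of h] assms by (metis of_int_le_iff order_trans)
  then have le: "\<forall>v\<in>vertices. \<forall>w\<in>vertices.
      h $ 1 * (v $ 1 - w $ 1) + h $ 2 * (v $ 2 - w $ 2) + h $ 3 * (v $ 3 - w $ 3) \<le> k"
    by (simp add: sum_3)
  show "\<bar>4 * h $ 2\<bar> \<le> k" "\<bar>h $ 2 + 11 * h $ 3\<bar> \<le> k"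
    "\<bar>10 * h $ 2 - 10 * h $ 3\<bar> \<le> k" "\<bar>h $ 1 - 10 * h $ 3\<bar> \<le> k"
    "\<bar>h $ 1 - 9 * h $ 2 + 11 * h $ 3\<bar> \<le> k"
    using le unfolding vertices_def by (simp_all add: abs_le_iff)
qed

lemma lattice_width_hull_P: "lattice_width hull_P = 1"
  unfolding lattice_width_def
proof (rule Least_equality)
  have ge: "1 \<le> width hull_P (real_vec h)" if "h \<noteq> 0" for h
  proof (rule ccontr)
    assume "\<not> ?thesis"
    then have w: "width hull_P (real_vec h) < 1" by simp
    \<comment> \<open>The pairings are integers, so a width below 1 forces them to be at most
      0.\<close>
    have zero: "(\<Sum>i\<in>UNIV. h $ i * (v $ i - w $ i)) \<le> 0" if "v \<in> vertices" "w \<in> vertices" for v w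
    proof -
      have "real_of_int (\<Sum>i\<in>UNIV. h $ i * (v $ i - w $ i)) < real_of_int 1"
        using width_hull_P_ge[OF that, of h] w by simp
      then show ?thesis unfolding of_int_less_iff by simp
    qed
    \<comment> \<open>Used in both orders, \<open>zero\<close> makes h orthogonal to the linearly
      independent vectors (0,4,0), (0,1,11) and (-1,0,10).\<close>
    have "h $ 1 = 0 \<and> h $ 2 = 0 \<and> h $ 3 = 0"
      using zero[of "vector [0, 2, 5]" "vector [0, -2, 5]"] zero[of "vector [0, -2, 5]" "vector [0, 2, 5]"]
        zero[of "vector [0, 2, 5]" "vector [0, 1, -6]"] zero[of "vector [0, 1, -6]" "vector [0, 2, 5]"]
        zero[of "vector [0, 2, 5]" "vector [1, 2, -5]"] zero[of "vector [1, 2, -5]" "vector [0, 2, 5]"]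
      by (simp add: vertices_def sum_3)
    then show False using that by (simp add: vec_eq_iff forall_3)
  qed
  have nz: "axis 1 1 \<noteq> (0 :: int ^ 3)" by (simp add: axis_eq_0_iff)
  have "primitive (axis 1 1 :: int ^ 3)"
    unfolding primitive_def by (rule Gcd_eq_1_I[of 1]) (auto intro!: image_eqI[of _ _ 1])
  moreover have "1 = width hull_P (real_vec (axis 1 1))"
    using ge[OF nz] width_hull_P_coord(1) by simp
  ultimately show "\<exists>h :: int ^ 3. h \<noteq> 0 \<and> primitive h \<and> 1 = width hull_P (real_vec h)"
    using nz by blast
  show "1 \<le> w" if "\<exists>h :: int ^ 3. h \<noteq> 0 \<and> primitive h \<and> w = width hull_P (real_vec h)" for w
    using that ge by blast
qed

section \<open>Short vectors and the shape of reduced bases\<close>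

definition on_e1 :: "int ^ 3 \<Rightarrow> bool" where
  "on_e1 h \<longleftrightarrow> h $ 2 = 0 \<and> h $ 3 = 0"

text \<open>The first coordinate stays free because it cancels or is absent in the final
  estimate.\<close>

definition type_e2 :: "int ^ 3 \<Rightarrow> bool" where
  "type_e2 h \<longleftrightarrow> h $ 3 = 0 \<and> \<bar>h $ 2\<bar> = 1"

definition type_e3 :: "int ^ 3 \<Rightarrow> bool" where
  "type_e3 h \<longleftrightarrow> h $ 2 = 0 \<and> \<bar>h $ 3\<bar> = 1 \<and> h $ 1 \<in> {0, - h $ 3}"

text \<open>The first three bounds of \<open>width_bound_imp\<close> confine \<open>h $ 2\<close>
  and \<open>h $ 3\<close> to {-1, 0, 1}, and \<open>h $ 2 = 0\<close> whenever \<open>h $ 3\<close>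
  is nonzero. For \<open>h $ 3 = 1\<close> the last two bounds then leave -1 <= \<open>h $ 1\<close>
  <= 0; the case -1 is symmetric.\<close>

lemma short_vector_cases:
  assumes "width hull_P (real_vec h) \<le> 11"
  shows "on_e1 h \<or> type_e2 h \<or> type_e3 h"
proof -
  have "width hull_P (real_vec h) \<le> real_of_int 11" using assms by simp
  note b = width_bound_imp[OF this]
  have z: "h $ 3 = -1 \<or> h $ 3 = 0 \<or> h $ 3 = 1" using b(1,2) by arith
  have y: "h $ 2 = -1 \<or> h $ 2 = 0 \<or> h $ 2 = 1" using b(1-3) by arith
  from z y b show ?thesis
    unfolding on_e1_def type_e2_def type_e3_def
    by (elim disjE) (simp_all add: abs_le_iff, arith+)
qed

lemma width_gt_1:
  assumes "\<not> on_e1 h"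
  shows "1 < width hull_P (real_vec h)"
proof (rule ccontr)
  assume "\<not> ?thesis"
  then have "width hull_P (real_vec h) \<le> real_of_int 1" by simp
  from width_bound_imp(1,2)[OF this] show False
    using assms unfolding on_e1_def by arith
qed

definition differ_by_e1 :: "int ^ 3 \<Rightarrow> int ^ 3 \<Rightarrow> bool" where
  "differ_by_e1 u v \<longleftrightarrow> {u + v, u - v} \<inter> {axis 1 1, - axis 1 1} \<noteq> {}"

text \<open>The conditions on h1 + h2 and h1 - h2, and the last condition of
  \<open>reduced_basis\<close> with one of m, n equal to 1 or -1 and the other 0, make u + v and u -
  v at least as wide as the later vector v. If one of them were e1 up to sign, v would have width at
  most 1, which happens only on the line of e1.\<close>

lemma reduced_not_differ:
  assumes red: "reduced_basis hull_P h1 h2 h3"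
    and ij: "(u, v) \<in> {(h1, h2), (h1, h3), (h2, h3)}"
    and off: "\<not> on_e1 v"
  shows "\<not> differ_by_e1 u v"
proof
  let ?N = "\<lambda>h. width hull_P (real_vec h)"
  have neg: "?N (- h) = ?N h" for h
    using width_scaleR[OF hull_P_bounded hull_P_nonempty, of "-1" "real_vec h"]
    by (simp add: real_vec_def vec_eq_iff) (metis vec_eq_iff vector_uminus_component vec_lambda_beta)
  assume "differ_by_e1 u v"
  then have "?N (u + v) \<le> 1 \<or> ?N (u - v) \<le> 1"
    using neg[of "axis 1 1"] width_hull_P_coord(1) by (auto simp: differ_by_e1_def)
  moreover have "?N v \<le> ?N (u + v) \<and> ?N v \<le> ?N (u - v)"
  proof -
    have 12: "?N h2 \<le> ?N (h1 + h2)" "?N h2 \<le> ?N (h1 - h2)"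
      and 3: "\<And>m n. ?N h3 \<le> ?N (m *s h1 + n *s h2 + h3)"
      using red by (auto simp: reduced_basis_def Let_def)
    have "?N h3 \<le> ?N (h1 + h3)" "?N h3 \<le> ?N (h3 - h1)"
      "?N h3 \<le> ?N (h2 + h3)" "?N h3 \<le> ?N (h3 - h2)"
      using 3[of 1 0] 3[of "-1" 0] 3[of 0 1] 3[of 0 "-1"]
      by (simp_all add: vector_sneg_minus1[symmetric])
    then show ?thesis
      using ij 12 neg[of "h3 - h1"] neg[of "h3 - h2"] by auto
  qed
  ultimately show False using width_gt_1[OF off] by linarith
qed

definition spans :: "int ^ 3 \<Rightarrow> int ^ 3 \<Rightarrow> int ^ 3 \<Rightarrow> bool" where
  "spans u v w \<longleftrightarrow> (\<forall>x. \<exists>a b c. x = a *s u + b *s v + c *s w)"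

lemma spans_swap:
  assumes s: "spans u v w"
  shows "spans v u w" "spans u w v"
proof -
  show "spans v u w"
    unfolding spans_def
  proof
    fix x
    obtain a b c where "x = a *s u + b *s v + c *s w" using s unfolding spans_def by blast
    then have "x = b *s v + a *s u + c *s w" by (simp add: add.commute)
    then show "\<exists>a b c. x = a *s v + b *s u + c *s w" by blast
  qed
  show "spans u w v"
    unfolding spans_def
  proof
    fix x
    obtain a b c where "x = a *s u + b *s v + c *s w" using s unfolding spans_def by blast
    then have "x = a *s u + c *s w + b *s v" by (simp add: algebra_simps)
    then show "\<exists>a b c. x = a *s u + b *s w + c *s v" by blast
  qed
qed

lemma spans_coord:
  assumes "spans u v w"
  obtains a b c where "\<And>j. a * u $ j + b * v $ j + c * w $ j = (if j = i then 1 else 0)"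
proof -
  obtain a b c where "axis i 1 = a *s u + b *s v + c *s w"
    using assms unfolding spans_def by blast
  then have "\<And>j. (a *s u + b *s v + c *s w) $ j = axis i 1 $ j" by simp
  then show ?thesis using that[of a b c] by (auto simp: axis_def)
qed

lemma spans_coord_nonzero:
  assumes "spans u v w"
  shows "u $ i \<noteq> 0 \<or> v $ i \<noteq> 0 \<or> w $ i \<noteq> 0"
proof -
  obtain a b c where "\<And>j. a * u $ j + b * v $ j + c * w $ j = (if j = i then 1 else 0)"
    using spans_coord[OF assms, of i] by blast
  from this[of i] show ?thesis by auto
qed

text \<open>In a combination giving e1, coordinate 3 eliminates w. The second coordinates of u and v
  are 1 or -1 and must cancel, so a multiple of u - v or u + v equals e1, and the multiplier is a
  unit.\<close>

lemma spans_two_type_e2: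
  assumes "spans u v w" "type_e2 u" "type_e2 v" "type_e3 w"
  shows "differ_by_e1 u v"
proof -
  obtain a b c where abc: "\<And>j. a * u $ j + b * v $ j + c * w $ j = (if j = 1 then 1 else 0)"
    using spans_coord[OF assms(1)] by blast
  have "c = 0" using abc[of 3] assms unfolding type_e2_def type_e3_def by auto
  have "a * u $ 2 + b * v $ 2 = 0" "a * u $ 1 + b * v $ 1 = 1"
    using abc[of 2] abc[of 1] \<open>c = 0\<close> by simp_all
  moreover have "u $ 2 = 1 \<or> u $ 2 = -1" "v $ 2 = 1 \<or> v $ 2 = -1"
    using assms unfolding type_e2_def by linarith+
  ultimately have "(u $ 2 = v $ 2 \<and> a * (u $ 1 - v $ 1) = 1) \<or> (u $ 2 = - v $ 2 \<and> a * (u $ 1 + v $ 1) = 1)"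
    by (auto simp: algebra_simps add_eq_0_iff)
  then have "(u $ 2 = v $ 2 \<and> \<bar>u $ 1 - v $ 1\<bar> = 1) \<or> (u $ 2 = - v $ 2 \<and> \<bar>u $ 1 + v $ 1\<bar> = 1)"
    by (auto simp: zmult_eq_1_iff)
  then show ?thesis
    using assms unfolding type_e2_def differ_by_e1_def
    by (auto simp: vec_eq_iff forall_3 axis_def abs_if split: if_splits)
qed

text \<open>The argument of \<open>spans_two_type_e2\<close> with coordinates 2 and 3
  exchanged.\<close>

lemma spans_two_type_e3:
  assumes "spans u v w" "type_e2 u" "type_e3 v" "type_e3 w"
  shows "differ_by_e1 v w"
proof -
  obtain a b c where abc: "\<And>j. a * u $ j + b * v $ j + c * w $ j = (if j = 1 then 1 else 0)"
    using spans_coord[OF assms(1)] by blast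
  have "a = 0" using abc[of 2] assms unfolding type_e2_def type_e3_def by auto
  have "b * v $ 3 + c * w $ 3 = 0" "b * v $ 1 + c * w $ 1 = 1"
    using abc[of 3] abc[of 1] \<open>a = 0\<close> by simp_all
  moreover have "v $ 3 = 1 \<or> v $ 3 = -1" "w $ 3 = 1 \<or> w $ 3 = -1"
    using assms unfolding type_e3_def by linarith+
  ultimately have "(v $ 3 = w $ 3 \<and> b * (v $ 1 - w $ 1) = 1) \<or> (v $ 3 = - w $ 3 \<and> b * (v $ 1 + w $ 1) = 1)"
    by (auto simp: algebra_simps add_eq_0_iff)
  then have "(v $ 3 = w $ 3 \<and> \<bar>v $ 1 - w $ 1\<bar> = 1) \<or> (v $ 3 = - w $ 3 \<and> \<bar>v $ 1 + w $ 1\<bar> = 1)"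
    by (auto simp: zmult_eq_1_iff)
  then show ?thesis
    using assms unfolding type_e3_def differ_by_e1_def
    by (auto simp: vec_eq_iff forall_3 axis_def abs_if split: if_splits)
qed

lemma spans_on_e1_unit:
  assumes "spans u v w" "on_e1 u" "type_e2 v" "type_e3 w"
  shows "\<bar>u $ 1\<bar> = 1"
proof -
  obtain a b c where abc: "\<And>j. a * u $ j + b * v $ j + c * w $ j = (if j = 1 then 1 else 0)"
    using spans_coord[OF assms(1)] by blast
  have "b = 0" using abc[of 2] assms unfolding on_e1_def type_e2_def type_e3_def by auto
  have "c = 0" using abc[of 3] assms unfolding on_e1_def type_e2_def type_e3_def by auto
  have "a * u $ 1 = 1" using abc[of 1] \<open>b = 0\<close> \<open>c = 0\<close> by simp
  then show ?thesis by (auto simp: zmult_eq_1_iff)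
qed

definition typed_basis :: "int ^ 3 \<Rightarrow> int ^ 3 \<Rightarrow> int ^ 3 \<Rightarrow> bool" where
  "typed_basis u v w \<longleftrightarrow> on_e1 u \<and> \<bar>u $ 1\<bar> = 1 \<and> type_e2 v \<and> type_e3 w"

text \<open>Generating e2 and e3 requires a member of each of \<open>type_e2\<close> and
  \<open>type_e3\<close>. If the remaining member also had one of these types, two members of equal
  type would differ by e1; so it lies on the line of e1, and generation of e1 makes it a unit
  there.\<close>

lemma reduced_basis_typed:
  assumes red: "reduced_basis hull_P h1 h2 h3"
  shows "typed_basis h1 h2 h3 \<or> typed_basis h1 h3 h2 \<or> typed_basis h2 h1 h3 \<or>
         typed_basis h2 h3 h1 \<or> typed_basis h3 h1 h2 \<or> typed_basis h3 h2 h1"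
proof -
  have "width hull_P (real_vec (axis i 1)) \<le> 11" for i
    using width_hull_P_coord exhaust_3[of i] by auto
  then have "width hull_P (real_vec h3) \<le> 11"
    by (rule reduced_basis_width_le[OF hull_P_bounded hull_P_nonempty red])
  then have short: "width hull_P (real_vec h) \<le> 11" if "h \<in> {h1, h2, h3}" for h
    using red that by (auto simp: reduced_basis_def Let_def)
  then have cases: "on_e1 h \<or> type_e2 h \<or> type_e3 h" if "h \<in> {h1, h2, h3}" for h
    using that short_vector_cases by blast
  have "spans h1 h2 h3"
    using red unfolding spans_def reduced_basis_def lattice_basis_def Let_def
    by (metis (mono_tags, lifting) case_prod_unfold)
  then have sp: "spans h1 h2 h3" "spans h1 h3 h2" "spans h2 h1 h3"
    "spans h2 h3 h1" "spans h3 h1 h2" "spans h3 h2 h1"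
    using spans_swap by blast+
  have e2: "type_e2 h1 \<or> type_e2 h2 \<or> type_e2 h3" and e3: "type_e3 h1 \<or> type_e3 h2 \<or> type_e3 h3"
    using cases[of h1] cases[of h2] cases[of h3]
      spans_coord_nonzero[OF sp(1), of 2] spans_coord_nonzero[OF sp(1), of 3]
    by (auto simp: on_e1_def type_e2_def type_e3_def)
  have off: "type_e2 h \<Longrightarrow> \<not> on_e1 h" "type_e3 h \<Longrightarrow> \<not> on_e1 h" for h
    by (auto simp: on_e1_def type_e2_def type_e3_def)
  have nd: "\<not> on_e1 h2 \<Longrightarrow> \<not> differ_by_e1 h1 h2" "\<not> on_e1 h3 \<Longrightarrow> \<not> differ_by_e1 h1 h3"
    "\<not> on_e1 h3 \<Longrightarrow> \<not> differ_by_e1 h2 h3"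
    using reduced_not_differ[OF red] by blast+
  have e2': "\<not> (type_e2 h1 \<and> type_e2 h2 \<and> type_e3 h3)" "\<not> (type_e2 h1 \<and> type_e2 h3 \<and> type_e3 h2)"
    "\<not> (type_e2 h2 \<and> type_e2 h3 \<and> type_e3 h1)"
    using nd off spans_two_type_e2 sp by blast+
  have e3': "\<not> (type_e2 h1 \<and> type_e3 h2 \<and> type_e3 h3)" "\<not> (type_e2 h2 \<and> type_e3 h1 \<and> type_e3 h3)"
    "\<not> (type_e2 h3 \<and> type_e3 h1 \<and> type_e3 h2)"
    using nd off spans_two_type_e3 sp by blast+
  have unit: "on_e1 u \<Longrightarrow> type_e2 v \<Longrightarrow> type_e3 w \<Longrightarrow> typed_basis u v w" if "spans u v w" for u v w
    using spans_on_e1_unit[OF that] by (simp add: typed_basis_def)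
  have disj: "\<not> (type_e2 h \<and> type_e3 h)" for h
    by (auto simp: type_e2_def type_e3_def)
  show ?thesis
    using cases[of h1, simplified] cases[of h2, simplified] cases[of h3, simplified]
      disj[of h1] disj[of h2] disj[of h3] e2 e3 e2' e3' unit[OF sp(1)] unit[OF sp(2)]
      unit[OF sp(3)] unit[OF sp(4)] unit[OF sp(5)] unit[OF sp(6)] by argo
qed

section \<open>Bounds for the two lattice sizes\<close>

lemma typed_basis_simplex_bound:
  assumes "typed_basis u v w"
    and pos: "\<And>p. p \<in> vertices \<Longrightarrow> 0 \<le> (\<Sum>i\<in>UNIV. u $ i * p $ i) + r"
      "\<And>p. p \<in> vertices \<Longrightarrow> 0 \<le> (\<Sum>i\<in>UNIV. v $ i * p $ i) + s"
      "\<And>p. p \<in> vertices \<Longrightarrow> 0 \<le> (\<Sum>i\<in>UNIV. w $ i * p $ i) + t"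
    and sum: "\<And>p. p \<in> vertices \<Longrightarrow> (\<Sum>i\<in>UNIV. u $ i * p $ i) + r +
      ((\<Sum>i\<in>UNIV. v $ i * p $ i) + s) + ((\<Sum>i\<in>UNIV. w $ i * p $ i) + t) \<le> l"
  shows "14 \<le> l"
proof -
  have u: "u $ 2 = 0" "u $ 3 = 0" "u $ 1 = 1 \<or> u $ 1 = -1"
    using assms(1) unfolding typed_basis_def on_e1_def by linarith+
  have v: "v $ 3 = 0" "v $ 2 = 1 \<or> v $ 2 = -1"
    using assms(1) unfolding typed_basis_def type_e2_def by linarith+
  have w: "w $ 2 = 0" "w $ 3 = 1 \<or> w $ 3 = -1" "w $ 1 = 0 \<or> w $ 1 = - w $ 3"
    using assms(1) unfolding typed_basis_def type_e3_def by auto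
  have "0 \<le> u $ 1 * p $ 1 + r \<and> 0 \<le> v $ 1 * p $ 1 + v $ 2 * p $ 2 + s
      \<and> 0 \<le> w $ 1 * p $ 1 + w $ 3 * p $ 3 + t
      \<and> u $ 1 * p $ 1 + r + (v $ 1 * p $ 1 + v $ 2 * p $ 2 + s) + (w $ 1 * p $ 1 + w $ 3 * p $ 3 + t) \<le> l"
    if "p \<in> vertices" for p
    using pos[OF that] sum[OF that] u(1,2) v(1) w(1) by (simp add: sum_3)
  note * = this[unfolded vertices_def]
  \<comment> \<open>The first three coordinate sums are taken at points with first coordinate 0,
    where \<open>u $ 1\<close>, \<open>v $ 1\<close> and \<open>w $ 1\<close> do not occur. The last
    one, at (1,-4,-3), is paired with positivity at (1,2,-5), so that \<open>v $ 1\<close>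
    cancels.\<close>
  have "0 \<le> r" "0 \<le> 2 * v $ 2 + s" "0 \<le> s - 2 * v $ 2" "0 \<le> 5 * w $ 3 + t" "0 \<le> t - 6 * w $ 3"
    "0 \<le> u $ 1 + r" "0 \<le> v $ 1 + 2 * v $ 2 + s"
    and "r + (2 * v $ 2 + s) + (5 * w $ 3 + t) \<le> l" "r + (s - 2 * v $ 2) + (5 * w $ 3 + t) \<le> l"
    "r + (v $ 2 + s) + (t - 6 * w $ 3) \<le> l"
    "u $ 1 + r + (v $ 1 - 4 * v $ 2 + s) + (w $ 1 - 3 * w $ 3 + t) \<le> l"
    using *[of "vector [0, 2, 5]"] *[of "vector [0, -2, 5]"] *[of "vector [0, 1, -6]"]
      *[of "vector [1, 2, -5]"] *[of "vector [1, -4, -3]"]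
    by (simp_all add: algebra_simps)
  \<comment> \<open>only the vertices that attain the relevant maxima\<close>
  note ineqs = this
  \<comment> \<open>The four sign patterns give the lower bounds 15, 14, 15 and 14. In the last,
    \<open>w $ 3 = -1\<close> leaves only 0 and 1 for \<open>w $ 1\<close>, and its nonnegativity
    enters the estimate.\<close>
  consider "v $ 2 = 1" "w $ 3 = 1" | "v $ 2 = 1" "w $ 3 = -1" | "v $ 2 = -1" "w $ 3 = 1"
    | "v $ 2 = -1" "w $ 3 = -1" "0 \<le> w $ 1"
    using v(2) w(2,3) by force
  then show ?thesis
  proof cases
    case 1
    then show ?thesis using ineqs(1,3,5,8) by linarith
  next
    case 2
    then show ?thesis using ineqs(1,3,4,10) by linarith
  next
    case 3
    then show ?thesis using ineqs(1,2,5,9) by linarith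
  next
    case 4
    then show ?thesis using ineqs(4,6,7,11) by linarith
  qed
qed

lemma typed_basis_uminus:
  "typed_basis (- u) v w = typed_basis u v w"
  "typed_basis u (- v) w = typed_basis u v w"
  "typed_basis u v (- w) = typed_basis u v w"
proof -
  have "(- a = b) = (a = - b)" for a b :: int by linarith
  then show "typed_basis (- u) v w = typed_basis u v w" "typed_basis u (- v) w = typed_basis u v w"
    "typed_basis u v (- w) = typed_basis u v w"
    by (simp_all add: typed_basis_def on_e1_def type_e2_def type_e3_def)
qed

lemma lattice_size_hull_P_le: "lattice_size hull_P \<le> 13"
proof -
  let ?A = "vector [vector [1, 0, 0], vector [0, -1, 0], vector [-8, -1, -1]] :: int ^ 3 ^ 3"
  let ?B = "vector [vector [1, 0, 0], vector [0, -1, 0], vector [-8, 1, -1]] :: int ^ 3 ^ 3"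
  \<comment> \<open>The shift sends (0,2,5), where all three rows are minimal, to the origin. The
    largest coordinate sum is then 13, attained at (0,1,-6), (1,-8,5) and (1,-4,-3).\<close>
  let ?T = "\<lambda>x. map_matrix real_of_int ?A *v x + real_vec (vector [0, 2, 7])"
  have "?A ** ?B = mat 1" "?B ** ?A = mat 1"
    by (simp_all add: vec_eq_iff forall_3 matrix_matrix_mult_def sum_3 mat_def)
  then have "?T \<in> AGL_int"
    unfolding AGL_int_def invertible_def by blast
  moreover have "?T ` hull_P \<subseteq> (*\<^sub>R) 13 ` std_simplex"
    unfolding hull_P_def
    by (subst affine_image_subset_simplex_iff)
      (simp_all add: vertices_def forall_3 matrix_vector_mult_def sum_3)
  ultimately show ?thesis
    using lattice_size_le[OF hull_P_def] by simp
qed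

lemma naive_lattice_size_typed_basis_ge:
  assumes types: "typed_basis h1 h2 h3 \<or> typed_basis h1 h3 h2 \<or> typed_basis h2 h1 h3 \<or>
      typed_basis h2 h3 h1 \<or> typed_basis h3 h1 h2 \<or> typed_basis h3 h2 h1"
  shows "14 \<le> naive_lattice_size ((*v) (map_matrix real_of_int (vector [h1, h2, h3])) ` hull_P)"
    (is "_ \<le> ?n")
proof -
  have fin: "finite vertices" by (simp add: vertices_def)
  obtain g :: "3 \<Rightarrow> int ^ 3" and t :: "int ^ 3"
    where g: "\<And>i. g i = vector [h1, h2, h3] $ i \<or> g i = - (vector [h1, h2, h3] $ i)"
    and pos: "\<And>v i. v \<in> vertices \<Longrightarrow> 0 \<le> (\<Sum>j\<in>UNIV. g i $ j * v $ j) + t $ i"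
    and le: "\<And>v. v \<in> vertices \<Longrightarrow>
      real_of_int (\<Sum>i\<in>UNIV. (\<Sum>j\<in>UNIV. g i $ j * v $ j) + t $ i) \<le> ?n"
    using naive_lattice_size_witness[OF fin refl, folded hull_P_def] by blast
  define c where "c i v = (\<Sum>j\<in>UNIV. g i $ j * v $ j) + t $ i" for i and v :: "int ^ 3"
  have c_le: "c 1 v + c 2 v + c 3 v \<le> \<lfloor>?n\<rfloor>" if "v \<in> vertices" for v
  proof -
    have "real_of_int (\<Sum>i\<in>UNIV. c i v) \<le> ?n"
      using le[OF that] unfolding c_def .
    then show ?thesis unfolding sum_3 le_floor_iff .
  qed
  have "typed_basis (g i) (g j) (g k) =
      typed_basis (vector [h1, h2, h3] $ i) (vector [h1, h2, h3] $ j) (vector [h1, h2, h3] $ k)" for i j k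
    using g[of i] g[of j] g[of k] by (elim disjE) (simp_all only: typed_basis_uminus)
  then have types: "typed_basis (g 1) (g 2) (g 3) \<or> typed_basis (g 1) (g 3) (g 2) \<or>
      typed_basis (g 2) (g 1) (g 3) \<or> typed_basis (g 2) (g 3) (g 1) \<or>
      typed_basis (g 3) (g 1) (g 2) \<or> typed_basis (g 3) (g 2) (g 1)"
    using types by (simp only: vector_3)
  \<comment> \<open>The coordinate sum is symmetric in the rows, so one estimate covers all six
    orders. The floor supplies the integer bound that \<open>typed_basis_simplex_bound\<close>
    expects.\<close>
  have bound: "14 \<le> \<lfloor>?n\<rfloor>"
    if "typed_basis (g i) (g j) (g k)" "\<And>v. c i v + c j v + c k v = c 1 v + c 2 v + c 3 v" for i j k
  proof (rule typed_basis_simplex_bound[OF that(1)])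
    fix p assume p: "p \<in> vertices"
    show "0 \<le> (\<Sum>m\<in>UNIV. g i $ m * p $ m) + t $ i" "0 \<le> (\<Sum>m\<in>UNIV. g j $ m * p $ m) + t $ j"
      "0 \<le> (\<Sum>m\<in>UNIV. g k $ m * p $ m) + t $ k"
      using pos[OF p] by blast+
    show "(\<Sum>m\<in>UNIV. g i $ m * p $ m) + t $ i + ((\<Sum>m\<in>UNIV. g j $ m * p $ m) + t $ j) +
        ((\<Sum>m\<in>UNIV. g k $ m * p $ m) + t $ k) \<le> \<lfloor>?n\<rfloor>"
      using c_le[OF p] that(2)[of p] unfolding c_def by linarith
  qed
  have "14 \<le> \<lfloor>?n\<rfloor>"
    using types by (elim disjE) (erule bound, linarith)+
  then show ?thesis by linarith
qed

theorem mainTheorem3: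
  fixes P :: "(real ^ 3) set"
  assumes P_def: "P = convex hull {vector [0, 2, 5], vector [0, -2, 5], vector [0, 1, -6],
                                   vector [1, -8, 5], vector [1, 2, -5], vector [1, -4, -3]}"
  shows "lattice_polytope P \<and> lattice_width P = 1 \<and>
         \<not> (\<exists>h1 h2 h3 :: int ^ 3. reduced_basis P h1 h2 h3 \<and> computes_lattice_size P h1 h2 h3)"
proof -
  have P: "P = hull_P" unfolding P_def hull_P_eq ..
  have False if "reduced_basis P h1 h2 h3" "computes_lattice_size P h1 h2 h3" for h1 h2 h3 :: "int ^ 3"
  proof -
    have "14 \<le> lattice_size hull_P"
      using that naive_lattice_size_typed_basis_ge[OF reduced_basis_typed]
      unfolding P computes_lattice_size_def by simp
    then show False using lattice_size_hull_P_le by simp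
  qed
  then show ?thesis
    using lattice_polytope_hull_P lattice_width_hull_P unfolding P by blast
qed

end
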